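(* Let $p\ge 1$. There are constants $c,C>0$ depending only on $p$ such that for every sufficiently small $\varepsilon>0$ and every $n\ge C(d\log d)/\varepsilon^2$ the following holds. Any randomized algorithm that, given $A\in\mathbb{R}^{n\times d}$, query access to the entries of an unknown $b\in\mathbb{R}^n$, and $f\in\mathsf{Lip}_1$, outputs $\hat x\in\mathbb{R}^d$ such that, for every such input, with probability at least $4/5$, $$\|f(A\hat x)-b\|_p^p\le \mathsf{OPT}+\varepsilon\big(\mathsf{OPT}+\|Ax^*\|_p^p\big),$$ must, on some input, make at least $c\,d/\varepsilon^2$ queries to the entries of $b$.
   Context: $\mathsf{Lip}_1$ is the set of $f:\mathbb{R}\to\mathbb{R}$ with $f(0)=0$ and $|f(x)-f(y)|\le|x-y|$; $f$ is applied entrywise to vectors. $\mathsf{OPT}:=\min_{x\in\mathbb{R}^d}\|f(Ax)-b\|_p^p$ and $x^*$ is a minimizer of $\|Ax\|_p^p$ among all $x$ attaining $\mathsf{OPT}$.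
   Formalization: Assumes d ≥ 2: for d = 1 the condition on n is vacuous (d log d = 0) and the claim fails, e.g. at n = d = 1, where one query suffices. The constants are stated for one arbitrary fixed seed set of the randomized algorithms. *)

theory Defs
  imports "HOL-Probability.Probability"
begin

text \<open>Vectors in R^m are modelled as functions nat => real (only indices < m matter);
  an n x d matrix is a function nat => nat => real (only entries i < n, j < d matter).\<close>

definition lip1 :: "(real \<Rightarrow> real) \<Rightarrow> bool" where
  "lip1 f \<longleftrightarrow> f 0 = 0 \<and> (\<forall>x y. \<bar>f x - f y\<bar> \<le> \<bar>x - y\<bar>)"

definition mat_vec :: "nat \<Rightarrow> (nat \<Rightarrow> nat \<Rightarrow> real) \<Rightarrow> (nat \<Rightarrow> real) \<Rightarrow> nat \<Rightarrow> real" where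
  "mat_vec d A x = (\<lambda>i. \<Sum>j<d. A i j * x j)"

definition loss :: "real \<Rightarrow> nat \<Rightarrow> nat \<Rightarrow> (nat \<Rightarrow> nat \<Rightarrow> real) \<Rightarrow> (real \<Rightarrow> real)
    \<Rightarrow> (nat \<Rightarrow> real) \<Rightarrow> (nat \<Rightarrow> real) \<Rightarrow> real" where
  "loss p n d A f b x = (\<Sum>i<n. \<bar>f (mat_vec d A x i) - b i\<bar> powr p)"

definition normAx :: "real \<Rightarrow> nat \<Rightarrow> nat \<Rightarrow> (nat \<Rightarrow> nat \<Rightarrow> real) \<Rightarrow> (nat \<Rightarrow> real) \<Rightarrow> real" where
  "normAx p n d A x = (\<Sum>i<n. \<bar>mat_vec d A x i\<bar> powr p)"

definition OPT :: "real \<Rightarrow> nat \<Rightarrow> nat \<Rightarrow> (nat \<Rightarrow> nat \<Rightarrow> real) \<Rightarrow> (real \<Rightarrow> real)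
    \<Rightarrow> (nat \<Rightarrow> real) \<Rightarrow> real" where
  "OPT p n d A f b = Inf (range (loss p n d A f b))"

definition minimizers :: "real \<Rightarrow> nat \<Rightarrow> nat \<Rightarrow> (nat \<Rightarrow> nat \<Rightarrow> real) \<Rightarrow> (real \<Rightarrow> real)
    \<Rightarrow> (nat \<Rightarrow> real) \<Rightarrow> (nat \<Rightarrow> real) set" where
  "minimizers p n d A f b = {x. loss p n d A f b x = OPT p n d A f b}"

text \<open>||Ax*||_p^p, where x* minimizes ||Ax||_p^p among all minimizers of the loss.\<close>
definition normAxstar :: "real \<Rightarrow> nat \<Rightarrow> nat \<Rightarrow> (nat \<Rightarrow> nat \<Rightarrow> real) \<Rightarrow> (real \<Rightarrow> real)
    \<Rightarrow> (nat \<Rightarrow> real) \<Rightarrow> real" where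
  "normAxstar p n d A f b = Inf (normAx p n d A ` minimizers p n d A f b)"

definition valid_input :: "nat \<Rightarrow> nat \<Rightarrow> (nat \<Rightarrow> nat \<Rightarrow> real) \<Rightarrow> (nat \<Rightarrow> real) \<Rightarrow> bool" where
  "valid_input n d A b \<longleftrightarrow> (\<forall>i j. (n \<le> i \<or> d \<le> j) \<longrightarrow> A i j = 0) \<and> (\<forall>i. n \<le> i \<longrightarrow> b i = 0)"

text \<open>A deterministic adaptive query strategy maps the list of answers obtained so far
  to either a new query (an index of b) or a final output.\<close>
datatype 'x step = Query nat | Output 'x

primrec trace :: "(real list \<Rightarrow> 'x step) \<Rightarrow> (nat \<Rightarrow> real) \<Rightarrow> nat \<Rightarrow> real list" where
  "trace S b 0 = []"
| "trace S b (Suc k) = (case S (trace S b k) of Query i \<Rightarrow> trace S b k @ [b i] | Output x \<Rightarrow> trace S b k)"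

definition halts :: "(real list \<Rightarrow> 'x step) \<Rightarrow> (nat \<Rightarrow> real) \<Rightarrow> nat \<Rightarrow> 'x \<Rightarrow> bool" where
  "halts S b k x \<longleftrightarrow> S (trace S b k) = Output x \<and> (\<forall>j<k. \<exists>i. S (trace S b j) = Query i)"

end

theory Submission
  imports Defs
begin

text \<open>Every column of the matrix owns a block of about \<open>1/\<epsilon>\<^sup>2\<close> hidden bits \<open>\<plusminus>1\<close>, and \<open>f\<close> clips to
  \<open>[0, 1]\<close>. As each bit is tested against both \<open>f x\<close> and \<open>f (-x)\<close>, at most one of which is nonzero, the
  optimal loss for given signs of the coordinates is affine in the number of bits that agree with
  the sign of their coordinate. If the bits of a block have mean \<open>\<plusminus>\<eta>\<close> with \<open>\<eta> = 100 \<epsilon>\<close>, a near-optimal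
  output has to recover the sign of the mean for most blocks, and telling the two means of one block
  apart takes about \<open>1/\<eta>\<^sup>2\<close> queries. Averaging over random signs and random bits turns this into a
  bound for randomized algorithms.\<close>

subsection \<open>Independent biased bits\<close>

definition bits :: "nat \<Rightarrow> (nat \<Rightarrow> real) set" where
  "bits N = {..<N} \<rightarrow>\<^sub>E {-1, 1}"

definition bit_weight :: "nat \<Rightarrow> (nat \<Rightarrow> real) \<Rightarrow> (nat \<Rightarrow> real) \<Rightarrow> real" where
  "bit_weight N q y = (\<Prod>i<N. (1 + q i * y i) / 2)"

text \<open>The bits are independent with means \<open>q i\<close>. A mean \<open>\<plusminus>1\<close> makes a bit deterministic,
  so that conditioning on \<open>y i = v\<close> is the same as replacing \<open>q\<close> by \<open>q(i := v)\<close>.\<close>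

definition bit_exp :: "nat \<Rightarrow> (nat \<Rightarrow> real) \<Rightarrow> ((nat \<Rightarrow> real) \<Rightarrow> real) \<Rightarrow> real" where
  "bit_exp N q h = (\<Sum>y\<in>bits N. bit_weight N q y * h y)"

lemma bits_cases: "y \<in> bits N \<Longrightarrow> i < N \<Longrightarrow> y i = -1 \<or> y i = 1"
  unfolding bits_def by (auto simp: PiE_iff)

lemma bits_square: "y \<in> bits N \<Longrightarrow> i < N \<Longrightarrow> y i * y i = 1"
  using bits_cases by fastforce

lemma bits_undefined: "y \<in> bits N \<Longrightarrow> N \<le> i \<Longrightarrow> y i = undefined"
  unfolding bits_def by (auto simp: PiE_iff extensional_def)

lemma ex_bits: "v = -1 \<or> v = 1 \<Longrightarrow> \<exists>y\<in>bits N. \<forall>i<N. y i = v"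
  by (intro bexI[of _ "restrict (\<lambda>_. v) {..<N}"]) (auto simp: bits_def)

lemma bits_update: "y \<in> bits N \<Longrightarrow> i < N \<Longrightarrow> v = -1 \<or> v = 1 \<Longrightarrow> y(i := v) \<in> bits N"
  unfolding bits_def by (auto simp: PiE_iff extensional_def)

lemma bit_weight_nonneg:
  assumes "\<And>i. i < N \<Longrightarrow> \<bar>q i\<bar> \<le> 1" and "y \<in> bits N"
  shows "0 \<le> bit_weight N q y"
  unfolding bit_weight_def
proof (rule prod_nonneg)
  fix i assume "i \<in> {..<N}"
  then show "0 \<le> (1 + q i * y i) / 2"
    using assms(1)[of i] bits_cases[OF assms(2), of i] by (auto simp: abs_le_iff)
qed

lemma sum_bit_weight: "(\<Sum>y\<in>bits N. bit_weight N q y) = 1"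
proof -
  have "(\<Prod>i<N. \<Sum>v\<in>{-1, 1}. (1 + q i * v) / 2) = (\<Sum>y\<in>bits N. bit_weight N q y)"
    unfolding bits_def bit_weight_def by (rule prod_sum_PiE) auto
  moreover have "(\<Sum>v\<in>{-1, 1}. (1 + q i * v) / 2) = 1" for i
    by (simp add: field_simps)
  ultimately show ?thesis by simp
qed

lemma bit_exp_const [simp]: "bit_exp N q (\<lambda>_. c) = c"
  unfolding bit_exp_def by (simp add: sum_bit_weight flip: sum_distrib_right)

lemma bit_exp_add: "bit_exp N q (\<lambda>y. g y + h y) = bit_exp N q g + bit_exp N q h"
  unfolding bit_exp_def by (simp add: distrib_left sum.distrib)

lemma bit_exp_cmult: "bit_exp N q (\<lambda>y. c * h y) = c * bit_exp N q h"
  unfolding bit_exp_def by (simp add: sum_distrib_left mult.left_commute)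

lemma bit_exp_sum: "bit_exp N q (\<lambda>y. \<Sum>j\<in>J. h j y) = (\<Sum>j\<in>J. bit_exp N q (h j))"
  unfolding bit_exp_def sum_distrib_left by (rule sum.swap)

lemma bit_exp_cong: "(\<And>y. y \<in> bits N \<Longrightarrow> g y = h y) \<Longrightarrow> bit_exp N q g = bit_exp N q h"
  unfolding bit_exp_def by (auto intro: sum.cong)

lemma bit_exp_mono:
  assumes "\<And>i. i < N \<Longrightarrow> \<bar>q i\<bar> \<le> 1" and "\<And>y. y \<in> bits N \<Longrightarrow> g y \<le> h y"
  shows "bit_exp N q g \<le> bit_exp N q h"
  unfolding bit_exp_def using assms by (intro sum_mono mult_left_mono bit_weight_nonneg)

lemma bit_weight_remove:
  assumes "i < N"
  shows "bit_weight N q y = (1 + q i * y i) / 2 * (\<Prod>k\<in>{..<N} - {i}. (1 + q k * y k) / 2)"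
  unfolding bit_weight_def using assms by (simp add: prod.remove)

text \<open>Total expectation over bit \<open>i\<close>: the weight is affine in \<open>q i\<close>,
  and \<open>q i\<close> is the combination of 1 and -1 with coefficients
  \<open>(1 + q i) / 2\<close> and \<open>(1 - q i) / 2\<close>.\<close>

lemma bit_exp_split:
  assumes "i < N"
  shows "bit_exp N q h = (1 + q i) / 2 * bit_exp N (q(i := 1)) h
                       + (1 - q i) / 2 * bit_exp N (q(i := -1)) h"
proof -
  have "bit_weight N q y = (1 + q i) / 2 * bit_weight N (q(i := 1)) y
                         + (1 - q i) / 2 * bit_weight N (q(i := -1)) y" for y
    by (simp add: bit_weight_remove[OF assms] field_simps)
  then show ?thesis
    unfolding bit_exp_def by (simp add: sum_distrib_left sum.distrib algebra_simps)
qed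

text \<open>When the mean of bit \<open>i\<close> is \<open>v\<close>, every vector with the
  opposite bit has weight 0.\<close>

lemma bit_exp_cong_fixed:
  assumes "i < N" and "q i = v" and "v = -1 \<or> v = 1"
    and "\<And>y. y \<in> bits N \<Longrightarrow> y i = v \<Longrightarrow> g y = h y"
  shows "bit_exp N q g = bit_exp N q h"
  unfolding bit_exp_def
proof (rule sum.cong)
  fix y assume y: "y \<in> bits N"
  show "bit_weight N q y * g y = bit_weight N q y * h y"
  proof (cases "y i = v")
    case False
    then have "1 + q i * y i = 0"
      using bits_cases[OF y assms(1)] assms(2,3) by auto
    then show ?thesis by (simp add: bit_weight_remove[OF assms(1)])
  qed (use assms(4) y in simp)
qed simp

text \<open>Flipping bit \<open>i\<close> is an involution of \<open>bits N\<close> that exchanges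
  the two weights, and \<open>h\<close> does not see it.\<close>

lemma bit_exp_independent:
  assumes "i < N" and "\<And>y v. y \<in> bits N \<Longrightarrow> v = -1 \<or> v = 1 \<Longrightarrow> h (y(i := v)) = h y"
  shows "bit_exp N (q(i := 1)) h = bit_exp N (q(i := -1)) h"
  unfolding bit_exp_def
proof (rule sum.reindex_bij_witness[of _ "\<lambda>y. y(i := - y i)" "\<lambda>y. y(i := - y i)"])
  fix y assume y: "y \<in> bits N"
  have v: "- y i = -1 \<or> - y i = 1"
    using bits_cases[OF y assms(1)] by auto
  show "y(i := - y i) \<in> bits N"
    by (rule bits_update[OF y assms(1) v])
  then show "y(i := - y i) \<in> bits N" .
  have "h (y(i := - y i)) = h y" by (rule assms(2)[OF y v])
  moreover have "bit_weight N (q(i := -1)) (y(i := - y i)) = bit_weight N (q(i := 1)) y"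
    unfolding bit_weight_def by (intro prod.cong) auto
  ultimately show "bit_weight N (q(i := -1)) (y(i := - y i)) * h (y(i := - y i))
      = bit_weight N (q(i := 1)) y * h y" by simp
qed auto

text \<open>Given \<open>y i = v\<close>, the first factor is the constant \<open>v - q i\<close>,
  and \<open>h\<close> has the same expectation for both values of \<open>v\<close>. The two
  contributions then cancel by \<open>bit_exp_split\<close>.\<close>

lemma bit_exp_centered_mult:
  assumes "i < N" and "\<And>y v. y \<in> bits N \<Longrightarrow> v = -1 \<or> v = 1 \<Longrightarrow> h (y(i := v)) = h y"
  shows "bit_exp N q (\<lambda>y. (y i - q i) * h y) = 0"
proof -
  have *: "bit_exp N (q(i := v)) (\<lambda>y. (y i - q i) * h y) = (v - q i) * bit_exp N (q(i := v)) h"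
    if v: "v = -1 \<or> v = 1" for v
  proof -
    have "bit_exp N (q(i := v)) (\<lambda>y. (y i - q i) * h y)
        = bit_exp N (q(i := v)) (\<lambda>y. (v - q i) * h y)"
      by (rule bit_exp_cong_fixed[OF assms(1) _ v]) auto
    then show ?thesis by (simp add: bit_exp_cmult)
  qed
  have "bit_exp N (q(i := 1)) h = bit_exp N (q(i := -1)) h"
    by (rule bit_exp_independent[OF assms])
  then show ?thesis
    unfolding bit_exp_split[OF assms(1), of q] *[of 1, simplified] *[of "-1", simplified]
    by (simp add: field_simps)
qed

text \<open>Variances of independent bits add up: in the induction the cross term has mean 0,
  because the new centered bit is independent of the old sum. As the square of a bit is 1, a single
  bit has variance \<open>1 - (q i)\<^sup>2\<close>.\<close>

lemma bit_exp_variance: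
  assumes "finite B" and "B \<subseteq> {..<N}"
  shows "bit_exp N q (\<lambda>y. (\<Sum>i\<in>B. y i - q i)\<^sup>2) = (\<Sum>i\<in>B. 1 - (q i)\<^sup>2)"
  using assms
proof (induction B rule: finite_induct)
  case (insert i B)
  then have i: "i < N" by auto
  let ?Z = "\<lambda>y. \<Sum>k\<in>B. y k - q k"
  have 0: "bit_exp N q (\<lambda>y. (y i - q i) * ?Z y) = 0"
    using insert.hyps by (intro bit_exp_centered_mult[OF i] sum.cong) auto
  have 1: "bit_exp N q (\<lambda>y. (y i - q i) * 1) = 0"
    by (rule bit_exp_centered_mult[OF i]) auto
  have "bit_exp N q (\<lambda>y. (\<Sum>k\<in>insert i B. y k - q k)\<^sup>2)
      = bit_exp N q (\<lambda>y. (1 - (q i)\<^sup>2) + (- 2 * q i) * ((y i - q i) * 1)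
                      + 2 * ((y i - q i) * ?Z y) + (?Z y)\<^sup>2)"
  proof (rule bit_exp_cong)
    fix y assume "y \<in> bits N"
    then have "y i * y i = 1" using bits_square i by blast
    then have "(y i - q i)\<^sup>2 = (1 - (q i)\<^sup>2) + (- 2 * q i) * ((y i - q i) * 1)"
      by (simp add: power2_eq_square algebra_simps)
    then show "(\<Sum>k\<in>insert i B. y k - q k)\<^sup>2
        = (1 - (q i)\<^sup>2) + (- 2 * q i) * ((y i - q i) * 1)
          + 2 * ((y i - q i) * ?Z y) + (?Z y)\<^sup>2"
      using insert.hyps by (simp add: power2_sum)
  qed
  also have "\<dots> = (1 - (q i)\<^sup>2) + (\<Sum>k\<in>B. 1 - (q k)\<^sup>2)"
    unfolding bit_exp_add bit_exp_cmult using 0 1 insert by simp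
  finally show ?case using insert.hyps by simp
qed simp

subsection \<open>Distinguishing two biases by adaptive queries\<close>

text \<open>\<open>trace\<close> grows at its end, which does not suit an induction that conditions
  on the first answer. Here the history is an argument and the step bound is the recursion variable.
  With no steps left a pending query gives \<open>undefined\<close>.\<close>

primrec run :: "(real list \<Rightarrow> 'x step) \<Rightarrow> (nat \<Rightarrow> real) \<Rightarrow> nat \<Rightarrow> real list \<Rightarrow> 'x" where
  "run S b 0 \<tau> = (case S \<tau> of Query r \<Rightarrow> undefined | Output x \<Rightarrow> x)"
| "run S b (Suc K) \<tau> = (case S \<tau> of Query r \<Rightarrow> run S b K (\<tau> @ [b r]) | Output x \<Rightarrow> x)"

primrec query_count ::
  "(real list \<Rightarrow> 'x step) \<Rightarrow> (nat \<Rightarrow> real) \<Rightarrow> nat set \<Rightarrow> nat \<Rightarrow> real list \<Rightarrow> real" where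
  "query_count S b R 0 \<tau> = 0"
| "query_count S b R (Suc K) \<tau> = (case S \<tau> of
      Query r \<Rightarrow> indicat_real R r + query_count S b R K (\<tau> @ [b r]) | Output x \<Rightarrow> 0)"

text \<open>Each step makes at most one query, and its index is counted by at most one of the sets
  \<open>R j\<close>.\<close>

lemma query_count_le:
  assumes "\<And>r. (\<Sum>j\<in>J. indicat_real (R j) r) \<le> 1"
  shows "(\<Sum>j\<in>J. query_count S b (R j) K \<tau>) \<le> real K"
proof (induction K arbitrary: \<tau>)
  case (Suc K)
  show ?case
  proof (cases "S \<tau>")
    case (Query r)
    then show ?thesis
      using Suc[of "\<tau> @ [b r]"] assms[of r] by (simp add: sum.distrib)
  qed simp
qed simp

text \<open>Link between the two execution models: each of the first \<open>k\<close> steps is a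
  query, so it uses up one unit of the step bound and appends one answer.\<close>

lemma run_eq_run_trace:
  assumes "\<And>i. i < k \<Longrightarrow> \<exists>r. S (trace S b i) = Query r" and "k \<le> K" and "j \<le> k"
  shows "run S b K [] = run S b (K - j) (trace S b j)"
  using assms(3)
proof (induction j)
  case (Suc j)
  then obtain r where "S (trace S b j) = Query r" using assms(1)[of j] by auto
  moreover have "K - j = Suc (K - Suc j)" using Suc assms(2) by simp
  ultimately show ?case using Suc by simp
qed simp

text \<open>Any step bound from the halting time on yields the output. \<open>K = k\<close>
  suffices, since \<open>run\<close> with bound 0 still reads off an output.\<close>

lemma halts_imp_run:
  assumes "halts S b k x" and "k \<le> K"
  shows "run S b K [] = x"
proof -
  have "run S b K [] = run S b (K - k) (trace S b k)"
    using assms by (intro run_eq_run_trace[where k = k]) (auto simp: halts_def)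
  then show ?thesis
    using assms by (cases "K - k") (auto simp: halts_def)
qed

text \<open>The inequality of arithmetic and geometric means, from the square of
  \<open>lam * t - A\<close>. The free parameter \<open>lam\<close> keeps the bound linear in the
  potential \<open>(a - a')\<^sup>2 / (a + a')\<close>, so that it can be averaged over answers and
  summed over blocks without square roots.\<close>

lemma weighted_difference_le:
  fixes a a' c lam :: real
  assumes "0 < lam" and "0 \<le> a" and "0 \<le> a'" and "\<bar>c\<bar> \<le> 1"
  shows "(a - a') * c \<le> lam / 2 * ((a - a')\<^sup>2 / (a + a')) + (a + a') / (2 * lam)"
proof (cases "a + a' = 0")
  case True
  then have "a = 0" "a' = 0" using assms by auto
  then show ?thesis by simp
next
  case False
  then have pos: "0 < a + a'" using assms by auto
  have "(a - a') * c \<le> \<bar>a - a'\<bar> * \<bar>c\<bar>" by (simp flip: abs_mult)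
  also have "\<dots> \<le> \<bar>a - a'\<bar> * 1" using assms(4) by (intro mult_left_mono) auto
  also have "\<bar>a - a'\<bar> * 1 \<le> lam / 2 * ((a - a')\<^sup>2 / (a + a')) + (a + a') / (2 * lam)"
  proof -
    have "t \<le> lam / 2 * (t\<^sup>2 / A) + A / (2 * lam)" if "0 < A" for t A
    proof -
      have "0 \<le> (lam * t - A)\<^sup>2 / (2 * lam * A)"
        using assms(1) that by simp
      also have "\<dots> = lam / 2 * (t\<^sup>2 / A) + A / (2 * lam) - t"
        using assms(1) that by (simp add: field_simps power2_eq_square)
      finally show ?thesis by simp
    qed
    from this[OF pos, of "\<bar>a - a'\<bar>"] show ?thesis by simp
  qed
  finally show ?thesis .
qed

text \<open>Effect on the potential of querying one bit of mean \<eta> under \<open>a\<close> and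
  -\<eta> under \<open>a'\<close>. With \<open>A = a + a'\<close> and
  \<open>m = (a - a') / A\<close>, the two answers change \<open>m\<close> to
  \<open>(m + \<eta>) / (1 + \<eta> * m)\<close> and \<open>(m - \<eta>) / (1 - \<eta> * m)\<close>,
  and the claim becomes an inequality in \<open>m\<close> and \<eta> alone.\<close>

lemma chi_square_step:
  fixes a a' \<eta> :: real
  assumes "0 \<le> a" and "0 \<le> a'" and "\<bar>\<eta>\<bar> < 1"
  shows "((1 + \<eta>) / 2 * a - (1 - \<eta>) / 2 * a')\<^sup>2 / ((1 + \<eta>) / 2 * a + (1 - \<eta>) / 2 * a')
       + ((1 - \<eta>) / 2 * a - (1 + \<eta>) / 2 * a')\<^sup>2 / ((1 - \<eta>) / 2 * a + (1 + \<eta>) / 2 * a')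
     \<le> (a - a')\<^sup>2 / (a + a') + \<eta>\<^sup>2 * (a + a')" (is "?L \<le> _")
proof (cases "a + a' = 0")
  case True
  then have "a = 0" "a' = 0" using assms by auto
  then show ?thesis by simp
next
  case False
  define A where "A = a + a'"
  define m where "m = (a - a') / A"
  have A: "0 < A" using False assms by (auto simp: A_def)
  have a: "a = A * (1 + m) / 2" and a': "a' = A * (1 - m) / 2"
    using A unfolding m_def by (auto simp: field_simps A_def)
  have m: "\<bar>m\<bar> \<le> 1" using A assms unfolding m_def by (auto simp: A_def field_simps abs_le_iff)
  have m2: "m\<^sup>2 \<le> 1" and \<eta>2: "\<eta>\<^sup>2 < 1"
    using m assms(3) by (auto simp: abs_square_le_1 abs_square_less_1)
  have "\<bar>\<eta> * m\<bar> \<le> \<bar>\<eta>\<bar> * 1" unfolding abs_mult using m by (intro mult_left_mono) auto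
  then have em: "\<bar>\<eta> * m\<bar> < 1" using assms(3) by simp
  then have p: "0 < 1 + \<eta> * m" "0 < 1 - \<eta> * m" by auto
  have e1: "(1 + \<eta>) / 2 * a - (1 - \<eta>) / 2 * a' = A / 2 * (m + \<eta>)"
    "(1 + \<eta>) / 2 * a + (1 - \<eta>) / 2 * a' = A / 2 * (1 + \<eta> * m)"
    "(1 - \<eta>) / 2 * a - (1 + \<eta>) / 2 * a' = A / 2 * (m - \<eta>)"
    "(1 - \<eta>) / 2 * a + (1 + \<eta>) / 2 * a' = A / 2 * (1 - \<eta> * m)"
    unfolding a a' by (auto simp: field_simps)
  have q: "(A / 2 * x)\<^sup>2 / (A / 2 * z) = A / 2 * (x\<^sup>2 / z)" for x z
    using A by (simp add: power2_eq_square)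
  have "?L = A / 2 * ((m + \<eta>)\<^sup>2 / (1 + \<eta> * m) + (m - \<eta>)\<^sup>2 / (1 - \<eta> * m))"
    unfolding e1 q by (simp add: distrib_left)
  also have "\<dots> \<le> A / 2 * (2 * (m\<^sup>2 + \<eta>\<^sup>2))"
  proof (intro mult_left_mono)
    have "(m + \<eta>)\<^sup>2 / (1 + \<eta> * m) + (m - \<eta>)\<^sup>2 / (1 - \<eta> * m)
        = (2 * (m\<^sup>2 + \<eta>\<^sup>2) - 4 * (m\<^sup>2 * \<eta>\<^sup>2)) / (1 - m\<^sup>2 * \<eta>\<^sup>2)"
    proof -
      have "1 - m\<^sup>2 * \<eta>\<^sup>2 = (1 + \<eta> * m) * (1 - \<eta> * m)"
        by (simp add: power2_eq_square algebra_simps)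
      then show ?thesis
        using p by (simp add: add_frac_eq) (simp add: power2_eq_square algebra_simps)
    qed
    also have "\<dots> \<le> 2 * (m\<^sup>2 + \<eta>\<^sup>2)"
    proof -
      have "0 < (1 + \<eta> * m) * (1 - \<eta> * m)" using p by simp
      then have "0 < 1 - m\<^sup>2 * \<eta>\<^sup>2" by (simp add: power2_eq_square algebra_simps)
      \<comment> \<open>Clearing the denominator leaves exactly this inequality, which holds because
        neither square exceeds 1.\<close>
      moreover have "(m\<^sup>2 * \<eta>\<^sup>2) * (m\<^sup>2 + \<eta>\<^sup>2) \<le> (m\<^sup>2 * \<eta>\<^sup>2) * 2"
        using m2 \<eta>2 by (intro mult_left_mono) auto
      ultimately show ?thesis by (simp add: pos_divide_le_eq algebra_simps)
    qed
    finally show "(m + \<eta>)\<^sup>2 / (1 + \<eta> * m) + (m - \<eta>)\<^sup>2 / (1 - \<eta> * m) \<le> 2 * (m\<^sup>2 + \<eta>\<^sup>2)" .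
  qed (use A in auto)
  also have "\<dots> = (a - a')\<^sup>2 / (a + a') + \<eta>\<^sup>2 * (a + a')"
  proof -
    have "a - a' = A * m" "a + a' = A" using A unfolding m_def by (auto simp: A_def)
    then show ?thesis using A by (simp add: power2_eq_square algebra_simps)
  qed
  finally show ?thesis .
qed

text \<open>The potential is \<open>(a - a')\<^sup>2 / (a + a')\<close>, where \<open>a\<close> and \<open>a'\<close> are the probabilities of the answers
  seen so far under the two hypotheses. A query of a bit in \<open>J\<close> raises its expectation by at most
  \<open>\<eta>\<^sup>2 * (a + a')\<close>, any other query leaves it unchanged. If \<open>a + a' = 0\<close>, then \<open>a = a' = 0\<close>
  and the quotient is \<open>0\<close>, as needed.\<close>

lemma adaptive_two_point:
  fixes \<beta> :: "nat \<Rightarrow> nat" and B :: "(nat \<Rightarrow> real) \<Rightarrow> nat \<Rightarrow> real"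
  assumes dep: "\<And>y y' r. y \<in> bits N \<Longrightarrow> y' \<in> bits N \<Longrightarrow> y (\<beta> r) = y' (\<beta> r) \<Longrightarrow> B y r = B y' r"
    and lam: "0 < lam" and \<eta>: "\<bar>\<eta>\<bar> < 1" and g: "\<And>x. \<bar>g x\<bar> \<le> 1"
  shows "0 \<le> a \<Longrightarrow> 0 \<le> a' \<Longrightarrow>
    (\<And>i. i < N \<Longrightarrow> \<bar>q i\<bar> \<le> 1) \<Longrightarrow>
    (\<And>i. i < N \<Longrightarrow> q i = q' i \<or> i \<in> J \<and> q i = \<eta> \<and> q' i = -\<eta>) \<Longrightarrow>
    a * bit_exp N q (\<lambda>y. g (run S (B y) K \<tau>)) - a' * bit_exp N q' (\<lambda>y. g (run S (B y) K \<tau>))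
    \<le> lam / 2 * ((a - a')\<^sup>2 / (a + a')
         + \<eta>\<^sup>2 * (a * bit_exp N q (\<lambda>y. query_count S (B y) (\<beta> -` J) K \<tau>)
               + a' * bit_exp N q' (\<lambda>y. query_count S (B y) (\<beta> -` J) K \<tau>)))
      + (a + a') / (2 * lam)"
proof (induction K arbitrary: \<tau> q q' a a')
  \<comment> \<open>With no steps left the output, possibly \<open>undefined\<close>, does not
    depend on the bits, so both expectations are the same constant.\<close>
  case 0
  then show ?case
    using weighted_difference_le[OF lam 0(1,2) g, of "run S b 0 \<tau>" for b] by (simp add: algebra_simps)
next
  case (Suc K)
  show ?case
  proof (cases "S \<tau>")
    case (Output x)
    then show ?thesis
      using weighted_difference_le[OF lam Suc.prems(1,2) g, of x] by (simp add: algebra_simps)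
  next
    case (Query r)
    define i where "i = \<beta> r"
    define F where "F = (\<lambda>\<tau> y. g (run S (B y) K \<tau>))"
    define N' where "N' = (\<lambda>\<tau> y. query_count S (B y) (\<beta> -` J) K \<tau>)"
    have folds: "(\<lambda>y. g (run S (B y) K \<tau>)) = F \<tau>"
      "(\<lambda>y. query_count S (B y) (\<beta> -` J) K \<tau>) = N' \<tau>" for \<tau>
      by (auto simp: F_def N'_def)
    note IH = Suc.IH[unfolded folds]
    \<comment> \<open>The answer to a query depends on a single bit, so the two constant vectors
      represent the two possible answers.\<close>
    obtain y1 where y1: "y1 \<in> bits N" "\<And>k. k < N \<Longrightarrow> y1 k = 1" using ex_bits[of 1] by blast
    obtain y0 where y0: "y0 \<in> bits N" "\<And>k. k < N \<Longrightarrow> y0 k = -1" using ex_bits[of "-1"] by blast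
    have unfold: "(\<lambda>y. g (run S (B y) (Suc K) \<tau>)) = (\<lambda>y. F (\<tau> @ [B y r]) y)"
      "(\<lambda>y. query_count S (B y) (\<beta> -` J) (Suc K) \<tau>) = (\<lambda>y. indicat_real J i + N' (\<tau> @ [B y r]) y)"
      using Query by (auto simp: F_def N'_def i_def indicator_def)
    have q': "\<And>i. i < N \<Longrightarrow> \<bar>q' i\<bar> \<le> 1" using Suc.prems(3,4) by (metis abs_minus_cancel)
    show ?thesis
    proof (cases "i < N")
      \<comment> \<open>Beyond \<open>N\<close> all elements of \<open>bits N\<close> take the value
        \<open>undefined\<close>, so the answer is known in advance and reveals nothing. Counting
        the query can only enlarge the right-hand side.\<close>
      case False
      then have "B y r = B y1 r" if "y \<in> bits N" for y
        using that y1(1) bits_undefined[OF that, of i] bits_undefined[OF y1(1), of i]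
        by (intro dep) (auto simp: i_def)
      then have e: "bit_exp N q (\<lambda>y. F (\<tau> @ [B y r]) y) = bit_exp N q (F (\<tau> @ [B y1 r]))"
        "bit_exp N q (\<lambda>y. N' (\<tau> @ [B y r]) y) = bit_exp N q (N' (\<tau> @ [B y1 r]))" for q
        by (auto intro: bit_exp_cong)
      have "0 \<le> lam / 2 * (\<eta>\<^sup>2 * (a * indicat_real J i + a' * indicat_real J i))"
        using Suc.prems(1,2) lam by simp
      then show ?thesis
        using IH[OF Suc.prems, of "\<tau> @ [B y1 r]"]
        unfolding unfold bit_exp_add bit_exp_const e by (simp add: algebra_simps)
    next
      case True
      define \<tau>1 where "\<tau>1 = \<tau> @ [B y1 r]"
      define \<tau>0 where "\<tau>0 = \<tau> @ [B y0 r]"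
      have B1: "B y r = B y1 r" if "y \<in> bits N" "y i = 1" for y
        using that y1 True by (intro dep) (auto simp: i_def)
      have B0: "B y r = B y0 r" if "y \<in> bits N" "y i = -1" for y
        using that y0 True by (intro dep) (auto simp: i_def)
      have split: "bit_exp N q (\<lambda>y. h (\<tau> @ [B y r]) y)
         = (1 + q i) / 2 * bit_exp N (q(i := 1)) (h \<tau>1) + (1 - q i) / 2 * bit_exp N (q(i := -1)) (h \<tau>0)"
        for q and h :: "real list \<Rightarrow> (nat \<Rightarrow> real) \<Rightarrow> real"
      proof -
        have "bit_exp N (q(i := 1)) (\<lambda>y. h (\<tau> @ [B y r]) y) = bit_exp N (q(i := 1)) (h \<tau>1)"
          by (rule bit_exp_cong_fixed[OF True, of _ 1]) (auto simp: B1 \<tau>1_def)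
        moreover have "bit_exp N (q(i := -1)) (\<lambda>y. h (\<tau> @ [B y r]) y) = bit_exp N (q(i := -1)) (h \<tau>0)"
          by (rule bit_exp_cong_fixed[OF True, of _ "-1"]) (auto simp: B0 \<tau>0_def)
        ultimately show ?thesis by (simp add: bit_exp_split[OF True, of q])
      qed
      \<comment> \<open>The weights \<open>a\<close> and \<open>a'\<close> multiplied by the
        probabilities of the answers from bit values 1 and -1 under the two hypotheses. They replace
        \<open>a\<close> and \<open>a'\<close> in the two uses of the induction hypothesis.\<close>
      define b1 b1' b0 b0' where "b1 = (1 + q i) / 2 * a" and "b1' = (1 + q' i) / 2 * a'"
        and "b0 = (1 - q i) / 2 * a" and "b0' = (1 - q' i) / 2 * a'"
      have qi: "\<bar>q i\<bar> \<le> 1" "\<bar>q' i\<bar> \<le> 1" using Suc.prems(3) q' True by auto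
      have nonneg: "0 \<le> b1" "0 \<le> b1'" "0 \<le> b0" "0 \<le> b0'"
        unfolding b1_def b1'_def b0_def b0'_def using qi Suc.prems(1,2) by (auto simp: abs_le_iff)
      have IH1: "b1 * bit_exp N (q(i := 1)) (F \<tau>1) - b1' * bit_exp N (q'(i := 1)) (F \<tau>1)
         \<le> lam / 2 * ((b1 - b1')\<^sup>2 / (b1 + b1') + \<eta>\<^sup>2 *
              (b1 * bit_exp N (q(i := 1)) (N' \<tau>1) + b1' * bit_exp N (q'(i := 1)) (N' \<tau>1)))
           + (b1 + b1') / (2 * lam)"
        using Suc.prems(3,4) by (intro IH nonneg) auto
      have IH0: "b0 * bit_exp N (q(i := -1)) (F \<tau>0) - b0' * bit_exp N (q'(i := -1)) (F \<tau>0)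
         \<le> lam / 2 * ((b0 - b0')\<^sup>2 / (b0 + b0') + \<eta>\<^sup>2 *
              (b0 * bit_exp N (q(i := -1)) (N' \<tau>0) + b0' * bit_exp N (q'(i := -1)) (N' \<tau>0)))
           + (b0 + b0') / (2 * lam)"
        using Suc.prems(3,4) by (intro IH nonneg) auto
      have pot: "(b1 - b1')\<^sup>2 / (b1 + b1') + (b0 - b0')\<^sup>2 / (b0 + b0')
          \<le> (a - a')\<^sup>2 / (a + a') + \<eta>\<^sup>2 * (a * indicat_real J i + a' * indicat_real J i)"
      proof (cases "q i = q' i")
        case True
        \<comment> \<open>The potential is homogeneous of degree 1, so an answer with the same
          probability under both hypotheses merely rescales it. For \<open>t = 0\<close> both sides
          are 0 by the convention for division.\<close>
        have h: "(t * a - t * a')\<^sup>2 / (t * a + t * a') = t * ((a - a')\<^sup>2 / (a + a'))" for t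
        proof (cases "t = 0")
          case False
          have "(t * a - t * a')\<^sup>2 / (t * a + t * a') = (t * (t * (a - a')\<^sup>2)) / (t * (a + a'))"
            by (simp add: power2_eq_square algebra_simps)
          then show ?thesis using False by simp
        qed simp
        have "(1 + t) / 2 * D + (1 - t) / 2 * D = D" for t D :: real by (simp add: field_simps)
        then have "(b1 - b1')\<^sup>2 / (b1 + b1') + (b0 - b0')\<^sup>2 / (b0 + b0') = (a - a')\<^sup>2 / (a + a')"
          unfolding b1_def b1'_def b0_def b0'_def True h .
        moreover have "0 \<le> \<eta>\<^sup>2 * (a * indicat_real J i + a' * indicat_real J i)"
          using Suc.prems(1,2) by simp
        ultimately show ?thesis by simp
      next
        case False
        then have "i \<in> J" "q i = \<eta>" "q' i = - \<eta>" using Suc.prems(4)[OF True] by auto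
        then show ?thesis
          using chi_square_step[OF Suc.prems(1,2) \<eta>] unfolding b1_def b1'_def b0_def b0'_def by simp
      qed
      have tot: "b1 + b1' + (b0 + b0') = a + a'"
        unfolding b1_def b1'_def b0_def b0'_def by (simp add: field_simps)
      \<comment> \<open>The addition of the two induction hypotheses, with the expectations
        abstracted to plain reals.\<close>
      have comb: "lhs1 + lhs0 \<le> lam / 2 * (P + \<eta>\<^sup>2 * (I + (n1 + n0))) + W / (2 * lam)"
        if "lhs1 \<le> lam / 2 * (P1 + \<eta>\<^sup>2 * n1) + w1 / (2 * lam)"
          "lhs0 \<le> lam / 2 * (P0 + \<eta>\<^sup>2 * n0) + w0 / (2 * lam)"
          "P1 + P0 \<le> P + \<eta>\<^sup>2 * I" "w1 + w0 = W" for lhs1 lhs0 P P1 P0 I n1 n0 w1 w0 W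
      proof -
        have "lhs1 + lhs0 \<le> lam / 2 * (P1 + P0 + \<eta>\<^sup>2 * (n1 + n0)) + W / (2 * lam)"
          using that(1,2) unfolding that(4)[symmetric] by (simp add: algebra_simps add_divide_distrib)
        also have "lam / 2 * (P1 + P0 + \<eta>\<^sup>2 * (n1 + n0)) \<le> lam / 2 * (P + \<eta>\<^sup>2 * I + \<eta>\<^sup>2 * (n1 + n0))"
          using that(3) lam by (intro mult_left_mono) auto
        finally show ?thesis by (simp add: algebra_simps)
      qed
      have "a * bit_exp N q (\<lambda>y. F (\<tau> @ [B y r]) y) - a' * bit_exp N q' (\<lambda>y. F (\<tau> @ [B y r]) y)
        = (b1 * bit_exp N (q(i := 1)) (F \<tau>1) - b1' * bit_exp N (q'(i := 1)) (F \<tau>1))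
        + (b0 * bit_exp N (q(i := -1)) (F \<tau>0) - b0' * bit_exp N (q'(i := -1)) (F \<tau>0))"
        unfolding split b1_def b1'_def b0_def b0'_def by (simp add: algebra_simps)
      also note comb[OF IH1 IH0 pot tot]
      finally show ?thesis
        unfolding unfold bit_exp_add bit_exp_const split b1_def b1'_def b0_def b0'_def
        by (simp add: algebra_simps)
    qed
  qed
qed

subsection \<open>The hard instance\<close>

definition clip :: "real \<Rightarrow> real" where
  "clip t = max 0 (min t 1)"

text \<open>Unlike \<open>sgn\<close>, this is 1 at 0, so every coordinate of an output counts as a
  guess of one of the two signs.\<close>

definition pm_sign :: "real \<Rightarrow> real" where
  "pm_sign t = (if 0 \<le> t then 1 else -1)"

text \<open>Bit \<open>i\<close> lives in rows \<open>4i, \<dots>, 4i + 3\<close> and in the block \<open>i div m\<close>. All four rows are supported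
  on the column of the block, with entries \<open>1, -1, 1, -1\<close> and targets \<open>1 + y i, 1 - y i, 2, 2\<close>.
  The last two rows make the clipped value \<open>1\<close> optimal once the sign of the coordinate is chosen.\<close>

definition hard_mat :: "nat \<Rightarrow> nat \<Rightarrow> nat \<Rightarrow> nat \<Rightarrow> real" where
  "hard_mat m d r c = (if r < 4 * (d * m) \<and> c = r div 4 div m then (if even r then 1 else -1) else 0)"

definition hard_vec :: "nat \<Rightarrow> nat \<Rightarrow> (nat \<Rightarrow> real) \<Rightarrow> nat \<Rightarrow> real" where
  "hard_vec m d y r = (if r < 4 * (d * m) then
     (if r mod 4 = 0 then 1 + y (r div 4) else if r mod 4 = 1 then 1 - y (r div 4) else 2) else 0)"

definition block_sum :: "nat \<Rightarrow> (nat \<Rightarrow> real) \<Rightarrow> nat \<Rightarrow> real" where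
  "block_sum m y j = (\<Sum>i\<in>{j * m..<j * m + m}. y i)"

lemma lip1_clip: "lip1 clip"
  unfolding lip1_def clip_def by (auto simp: max_def min_def abs_if)

lemma valid_input_hard:
  assumes "4 * (d * m) \<le> n"
  shows "valid_input n d (hard_mat m d) (hard_vec m d y)"
proof -
  have "r div 4 div m < d" if "r < 4 * (d * m)" for r
    using that by (simp add: less_mult_imp_div_less div_mult2_eq)
  then show ?thesis
    using assms unfolding valid_input_def hard_mat_def hard_vec_def by fastforce
qed

lemma sum_four:
  fixes h :: "nat \<Rightarrow> real"
  assumes "4 * N \<le> n" and "\<And>r. 4 * N \<le> r \<Longrightarrow> h r = 0"
  shows "(\<Sum>r<n. h r) = (\<Sum>i<N. h (4 * i) + h (4 * i + 1) + h (4 * i + 2) + h (4 * i + 3))"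
proof -
  have "(\<Sum>r<n. h r) = (\<Sum>r<N * 4. h r)"
    using assms by (intro sum.mono_neutral_right) auto
  also have "\<dots> = (\<Sum>i<N. sum h {i * 4..<i * 4 + 4})"
    by (simp add: sum.nat_group)
  also have "\<dots> = (\<Sum>i<N. h (4 * i) + h (4 * i + 1) + h (4 * i + 2) + h (4 * i + 3))"
  proof (rule sum.cong)
    fix i :: nat
    have "{i * 4..<i * 4 + 4} = {4 * i, 4 * i + 1, 4 * i + 2, 4 * i + 3}" by auto
    then show "sum h {i * 4..<i * 4 + 4} = h (4 * i) + h (4 * i + 1) + h (4 * i + 2) + h (4 * i + 3)"
      by (simp add: add.assoc)
  qed simp
  finally show ?thesis .
qed

lemma sum_blocks:
  fixes h :: "nat \<Rightarrow> real"
  shows "(\<Sum>i<d * m. h i) = (\<Sum>j<d. \<Sum>i\<in>{j * m..<j * m + m}. h i)"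
  by (simp add: sum.nat_group)

lemma mat_vec_hard:
  assumes "i < d * m"
  shows "mat_vec d (hard_mat m d) x (4 * i) = x (i div m)"
    "mat_vec d (hard_mat m d) x (4 * i + 1) = - x (i div m)"
    "mat_vec d (hard_mat m d) x (4 * i + 2) = x (i div m)"
    "mat_vec d (hard_mat m d) x (4 * i + 3) = - x (i div m)"
proof -
  have i: "i div m < d" using assms by (simp add: less_mult_imp_div_less)
  have *: "mat_vec d (hard_mat m d) x (4 * i + t) = (if even t then 1 else -1) * x (i div m)"
    if "t < 4" for t
  proof -
    have "(4 * i + t) div 4 = i" using that by simp
    moreover have "4 * i + t < 4 * (d * m)" using that assms by linarith
    moreover have "even (4 * i + t) = even t" by simp
    ultimately have "hard_mat m d (4 * i + t) c = (if c = i div m then (if even t then 1 else -1) else 0)" for c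
      unfolding hard_mat_def by presburger
    then show ?thesis
      unfolding mat_vec_def using i by (simp add: if_distrib[of "\<lambda>u. u * x _"] cong: if_cong)
  qed
  show "mat_vec d (hard_mat m d) x (4 * i) = x (i div m)" using *[of 0] by simp
  show "mat_vec d (hard_mat m d) x (4 * i + 1) = - x (i div m)" using *[of 1] by simp
  show "mat_vec d (hard_mat m d) x (4 * i + 2) = x (i div m)" using *[of 2] by simp
  show "mat_vec d (hard_mat m d) x (4 * i + 3) = - x (i div m)" using *[of 3] by simp
qed

lemma mat_vec_hard_zero: "4 * (d * m) \<le> r \<Longrightarrow> mat_vec d (hard_mat m d) x r = 0"
  unfolding mat_vec_def hard_mat_def by simp

lemma hard_vec_rows:
  assumes "i < d * m"
  shows "hard_vec m d y (4 * i) = 1 + y i" "hard_vec m d y (4 * i + 1) = 1 - y i"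
    "hard_vec m d y (4 * i + 2) = 2" "hard_vec m d y (4 * i + 3) = 2"
proof -
  have "(4 * i + 2) mod 4 = 2" "(4 * i + 3) mod 4 = 3" "(4 * i + 1) mod 4 = 1"
       "(4 * i + 1) div 4 = i" by presburger+
  moreover have "4 * i + 1 < 4 * (d * m)" "4 * i + 2 < 4 * (d * m)" "4 * i + 3 < 4 * (d * m)"
    using assms by linarith+
  ultimately show "hard_vec m d y (4 * i) = 1 + y i" "hard_vec m d y (4 * i + 1) = 1 - y i"
    "hard_vec m d y (4 * i + 2) = 2" "hard_vec m d y (4 * i + 3) = 2"
    unfolding hard_vec_def using assms by auto
qed

lemma hard_vec_dep:
  "y (r div 4) = y' (r div 4) \<Longrightarrow> hard_vec m d y r = hard_vec m d y' r"
  unfolding hard_vec_def by simp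

section \<open>The loss caused by a single bit\<close>

definition bit_loss :: "real \<Rightarrow> real \<Rightarrow> real \<Rightarrow> real" where
  "bit_loss p y x = \<bar>clip x - (1 + y)\<bar> powr p + \<bar>clip (- x) - (1 - y)\<bar> powr p
                  + \<bar>clip x - 2\<bar> powr p + \<bar>clip (- x) - 2\<bar> powr p"

lemma loss_hard:
  assumes "4 * (d * m) \<le> n"
  shows "loss p n d (hard_mat m d) clip (hard_vec m d y) x = (\<Sum>i<d * m. bit_loss p (y i) (x (i div m)))"
proof -
  have z: "hard_vec m d y r = 0" if "4 * (d * m) \<le> r" for r
    using that by (simp add: hard_vec_def)
  \<comment> \<open>The padding rows have matrix entries 0 and target 0, so they contribute
    nothing.\<close>
  have "clip 0 = 0" by (simp add: clip_def)
  then show ?thesis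
    unfolding loss_def
    by (subst sum_four[OF assms]) (auto simp: mat_vec_hard_zero z mat_vec_hard hard_vec_rows bit_loss_def
        simp del: add_2_eq_Suc' One_nat_def intro!: sum.cong)
qed

lemma normAx_hard:
  assumes "4 * (d * m) \<le> n" and "\<And>j. \<bar>x j\<bar> = 1"
  shows "normAx p n d (hard_mat m d) x = 4 * real (d * m)"
proof -
  let ?h = "\<lambda>r. \<bar>mat_vec d (hard_mat m d) x r\<bar> powr p"
  have "normAx p n d (hard_mat m d) x
      = (\<Sum>i<d * m. ?h (4 * i) + ?h (4 * i + 1) + ?h (4 * i + 2) + ?h (4 * i + 3))"
    unfolding normAx_def by (rule sum_four[OF assms(1)]) (simp add: mat_vec_hard_zero)
  also have "\<dots> = (\<Sum>i<d * m. 4)"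
    by (rule sum.cong) (simp_all only: lessThan_iff mat_vec_hard abs_minus_cancel assms(2), simp)
  finally show ?thesis by simp
qed

lemma powr_two_ge: "2 \<le> (2::real) powr p" if "1 \<le> p"
  using powr_mono[OF that, of "2::real"] by simp

text \<open>Convexity at 1, the midpoint of \<open>2 - v\<close> and \<open>v\<close>. Convexity is
  applied to positive arguments only, hence the separate case \<open>v = 0\<close>.\<close>

lemma powr_reflect_ge:
  fixes p v :: real
  assumes "1 \<le> p" and "0 \<le> v" and "v \<le> 1"
  shows "2 \<le> (2 - v) powr p + v powr p"
proof (cases "v = 0")
  case True
  then show ?thesis using powr_two_ge[OF assms(1)] by simp
next
  case False
  have "((1 - 1/2) *\<^sub>R (2 - v) + (1/2) *\<^sub>R v) powr p \<le> (1 - 1/2) * (2 - v) powr p + (1/2) * v powr p"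
    by (rule convex_onD[OF powr_convex[OF assms(1)]]) (use False assms in auto)
  then show ?thesis by (simp add: field_simps)
qed

text \<open>One of \<open>clip x\<close> and \<open>clip (- x)\<close> is 0; let \<open>u\<close> be
  the other. If the bit agrees with the sign of \<open>x\<close>, the loss is
  \<open>2 * (2 - u) powr p + 2 powr p\<close>, at least \<open>2 + 2 powr p\<close>. Otherwise it
  is \<open>u powr p + (2 - u) powr p + 2 * 2 powr p\<close>, at least
  \<open>2 + 2 * 2 powr p\<close>. The left-hand side interpolates these two bounds.\<close>

lemma bit_loss_ge:
  assumes p: "1 \<le> p" and y: "y = -1 \<or> y = 1"
  shows "2 + 3/2 * 2 powr p - 2 powr p / 2 * (pm_sign x * y) \<le> bit_loss p y x"
proof -
  have clip: "0 \<le> x \<Longrightarrow> clip (- x) = 0" "\<not> 0 \<le> x \<Longrightarrow> clip x = 0"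
    by (auto simp: clip_def)
  have b: "0 \<le> clip t" "clip t \<le> 1" for t by (auto simp: clip_def)
  have 1: "1 \<le> (2 - clip t) powr p" for t
    using b[of t] p by (intro ge_one_powr_ge_zero) auto
  have 2: "2 \<le> (2 - clip t) powr p + clip t powr p" for t
    by (rule powr_reflect_ge[OF p b])
  have a: "\<bar>clip t - 2\<bar> = 2 - clip t" "\<bar>clip t\<bar> = clip t" for t using b[of t] by auto
  show ?thesis
    using y 1[of x] 1[of "-x"] 2[of x] 2[of "-x"] clip
    unfolding bit_loss_def pm_sign_def by (auto simp: a)
qed

text \<open>The bound of \<open>bit_loss_ge\<close> is attained at \<open>u = 1\<close>, in both
  cases.\<close>

lemma bit_loss_eq:
  assumes p: "1 \<le> p" and y: "y = -1 \<or> y = 1" and x: "x = -1 \<or> x = 1"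
  shows "bit_loss p y x = 2 + 3/2 * 2 powr p - 2 powr p / 2 * (pm_sign x * y)"
  using x y unfolding bit_loss_def clip_def pm_sign_def by auto

lemma sum_affine_blocks:
  "(\<Sum>i<d * m. a - b * (o' (i div m) * y i)) = real (d * m) * a - b * (\<Sum>j<d. o' j * block_sum m y j)"
proof -
  have "(\<Sum>i<d * m. o' (i div m) * y i) = (\<Sum>j<d. \<Sum>i\<in>{j * m..<j * m + m}. o' (i div m) * y i)"
    by (rule sum_blocks)
  also have "\<dots> = (\<Sum>j<d. o' j * block_sum m y j)"
  proof (rule sum.cong)
    fix j
    have "i div m = j" if "i \<in> {j * m..<j * m + m}" for i
      using that by (intro div_nat_eqI) (auto simp: mult.commute)
    then show "(\<Sum>i\<in>{j * m..<j * m + m}. o' (i div m) * y i) = o' j * block_sum m y j"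
      unfolding block_sum_def sum_distrib_left by (intro sum.cong) auto
  qed simp
  finally show ?thesis by (simp add: sum_subtractf flip: sum_distrib_left)
qed

section \<open>Optimum and near-minimizers of the hard instance\<close>

context
  fixes p :: real and n m d :: nat and y :: "nat \<Rightarrow> real"
  assumes p: "1 \<le> p" and n: "4 * (d * m) \<le> n" and y: "y \<in> bits (d * m)"
begin

abbreviation "lossH \<equiv> loss p n d (hard_mat m d) clip (hard_vec m d y)"
abbreviation "OPTH \<equiv> OPT p n d (hard_mat m d) clip (hard_vec m d y)"

lemma loss_hard_ge:
  "real (d * m) * (2 + 3/2 * 2 powr p) - 2 powr p / 2 * (\<Sum>j<d. pm_sign (x j) * block_sum m y j) \<le> lossH x"
  unfolding loss_hard[OF n] using bit_loss_ge[OF p] bits_cases[OF y]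
  by (subst sum_affine_blocks[symmetric]) (intro sum_mono, auto)

lemma loss_hard_eq:
  assumes "\<And>j. x j = -1 \<or> x j = 1"
  shows "lossH x = real (d * m) * (2 + 3/2 * 2 powr p) - 2 powr p / 2 * (\<Sum>j<d. pm_sign (x j) * block_sum m y j)"
  unfolding loss_hard[OF n] using bit_loss_eq[OF p] bits_cases[OF y] assms
  by (subst sum_affine_blocks[symmetric]) (intro sum.cong, auto)

text \<open>A majority vote in each block, with ties going to 1.\<close>

definition best_signs :: "nat \<Rightarrow> real" where "best_signs j = pm_sign (block_sum m y j)"

lemma best_cases: "best_signs j = -1 \<or> best_signs j = 1"
  by (simp add: best_signs_def pm_sign_def)

lemma loss_best:
  "lossH best_signs = real (d * m) * (2 + 3/2 * 2 powr p) - 2 powr p / 2 * (\<Sum>j<d. \<bar>block_sum m y j\<bar>)"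
proof -
  have "pm_sign (best_signs j) * block_sum m y j = \<bar>block_sum m y j\<bar>" for j
    by (simp add: best_signs_def pm_sign_def)
  then show ?thesis using loss_hard_eq[OF best_cases] by simp
qed

lemma loss_best_le: "lossH best_signs \<le> lossH x"
proof -
  have "(\<Sum>j<d. pm_sign (x j) * block_sum m y j) \<le> (\<Sum>j<d. \<bar>block_sum m y j\<bar>)"
    by (intro sum_mono) (auto simp: pm_sign_def)
  then have "2 powr p / 2 * (\<Sum>j<d. pm_sign (x j) * block_sum m y j)
      \<le> 2 powr p / 2 * (\<Sum>j<d. \<bar>block_sum m y j\<bar>)"
    by (intro mult_left_mono) auto
  then show ?thesis using loss_hard_ge[of x] unfolding loss_best by linarith
qed

lemma OPT_hard: "OPTH = lossH best_signs"
  unfolding OPT_def by (rule cInf_eq_minimum) (auto intro: loss_best_le)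

lemma best_minimizer: "best_signs \<in> minimizers p n d (hard_mat m d) clip (hard_vec m d y)"
  unfolding minimizers_def by (simp add: OPT_hard)

text \<open>The infimum is at most the value at the minimizer \<open>best_signs\<close>, where each
  of the \<open>4 * (d * m)\<close> nonzero rows contributes 1. An upper bound suffices, as this
  quantity only enters the allowed error.\<close>

lemma normAxstar_hard_le: "normAxstar p n d (hard_mat m d) clip (hard_vec m d y) \<le> 4 * real (d * m)"
proof -
  have "\<bar>best_signs j\<bar> = 1" for j using best_cases[of j] by auto
  then have "normAx p n d (hard_mat m d) best_signs = 4 * real (d * m)"
    by (intro normAx_hard[OF n])
  moreover have "bdd_below (normAx p n d (hard_mat m d) ` X)" for X
    by (rule bdd_belowI[of _ 0]) (auto simp: normAx_def intro!: sum_nonneg)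
  ultimately show ?thesis
    unfolding normAxstar_def using best_minimizer by (metis cInf_lower imageI)
qed

text \<open>By \<open>loss_hard_ge\<close> the excess loss is at least \<open>2 powr p / 2\<close>
  times the left-hand side. Since \<open>2 powr p\<close> is at least 2, the allowed error is at
  most \<epsilon> times \<open>9/2 * 2 powr p * (d * m)\<close>. The factor \<open>2 powr p\<close>
  cancels, which makes the final constants independent of \<open>p\<close>.\<close>

lemma approx_minimizer_signs:
  assumes "0 < \<epsilon>" and "lossH x \<le> OPTH
    + \<epsilon> * (OPTH + normAxstar p n d (hard_mat m d) clip (hard_vec m d y))"
  shows "(\<Sum>j<d. \<bar>block_sum m y j\<bar> - pm_sign (x j) * block_sum m y j) \<le> 9 * \<epsilon> * real (d * m)"
proof -
  let ?P = "2 powr p" and ?N = "real (d * m)"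
  have P: "2 \<le> ?P" by (rule powr_two_ge[OF p])
  have "0 \<le> ?P / 2 * (\<Sum>j<d. \<bar>block_sum m y j\<bar>)" by (intro mult_nonneg_nonneg sum_nonneg) auto
  then have "OPTH \<le> ?N * (2 + 3/2 * ?P)"
    unfolding OPT_hard loss_best by linarith
  then have "OPTH + normAxstar p n d (hard_mat m d) clip (hard_vec m d y) \<le> ?N * (2 + 3/2 * ?P) + 4 * ?N"
    using normAxstar_hard_le by linarith
  also have "\<dots> = ?N * (6 + 3/2 * ?P)" by (simp add: algebra_simps)
  also have "\<dots> \<le> ?N * (9/2 * ?P)" using P by (intro mult_left_mono) auto
  finally have "\<epsilon> * (OPTH + normAxstar p n d (hard_mat m d) clip (hard_vec m d y)) \<le> \<epsilon> * (?N * (9/2 * ?P))"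
    using assms(1) by (intro mult_left_mono) auto
  then have "?P / 2 * (\<Sum>j<d. \<bar>block_sum m y j\<bar>) - ?P / 2 * (\<Sum>j<d. pm_sign (x j) * block_sum m y j)
      \<le> \<epsilon> * (?N * (9/2 * ?P))"
    using assms(2) loss_hard_ge[of x] unfolding OPT_hard loss_best by linarith
  then have "?P / 2 * (\<Sum>j<d. \<bar>block_sum m y j\<bar> - pm_sign (x j) * block_sum m y j)
      \<le> ?P / 2 * (9 * \<epsilon> * ?N)"
    by (simp add: sum_subtractf algebra_simps)
  then show ?thesis using P by simp
qed

end

subsection \<open>Averaging over the hard inputs\<close>

text \<open>A bit of mean 0 has a symmetric distribution. Applied to the random signs, this
  exchanges the two hypotheses about one block.\<close>

lemma bit_exp_flip:
  assumes "j < N" and "q j = 0"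
  shows "bit_exp N q (\<lambda>y. h (y(j := - y j))) = bit_exp N q h"
  unfolding bit_exp_def
proof (rule sum.reindex_bij_witness[of _ "\<lambda>y. y(j := - y j)" "\<lambda>y. y(j := - y j)"])
  fix y assume y: "y \<in> bits N"
  show "y(j := - y j) \<in> bits N"
    using bits_cases[OF y assms(1)] by (intro bits_update[OF y assms(1)]) auto
  then show "y(j := - y j) \<in> bits N" .
  have "bit_weight N q (y(j := - y j)) = bit_weight N q y"
    unfolding bit_weight_def using assms(2) by (intro prod.cong) auto
  then show "bit_weight N q (y(j := - y j)) * h (y(j := - y j)) = bit_weight N q y * h (y(j := - y j))"
    by simp
qed auto

lemma bit_exp_integral:
  assumes "\<And>y. y \<in> bits N \<Longrightarrow> integrable M (h y)"
  shows "integrable M (\<lambda>\<omega>. bit_exp N q (\<lambda>y. h y \<omega>))"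
    and "(\<integral>\<omega>. bit_exp N q (\<lambda>y. h y \<omega>) \<partial>M) = bit_exp N q (\<lambda>y. \<integral>\<omega>. h y \<omega> \<partial>M)"
  unfolding bit_exp_def using assms by auto

lemma halts_unique:
  assumes "halts S b k x" and "halts S b k' x'"
  shows "x = x'"
  using halts_imp_run[OF assms(1), of "max k k'"] halts_imp_run[OF assms(2), of "max k k'"] by simp

definition bias :: "nat \<Rightarrow> real \<Rightarrow> (nat \<Rightarrow> real) \<Rightarrow> nat \<Rightarrow> real" where
  "bias m \<eta> s i = \<eta> * s (i div m)"

text \<open>The distribution of the hard input, in two stages: uniform independent signs
  \<open>s\<close>, one per block, and then independent bits, those of block \<open>j\<close> having
  mean \<open>\<eta> * s j\<close>. The integrand sees both stages.\<close>

definition mix :: "nat \<Rightarrow> nat \<Rightarrow> real \<Rightarrow> ((nat \<Rightarrow> real) \<Rightarrow> (nat \<Rightarrow> real) \<Rightarrow> real) \<Rightarrow> real" where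
  "mix d m \<eta> h = bit_exp d (\<lambda>_. 0) (\<lambda>s. bit_exp (d * m) (bias m \<eta> s) (h s))"

lemma bias_le:
  assumes "s \<in> bits d" and "\<bar>\<eta>\<bar> \<le> 1" and "i < d * m"
  shows "\<bar>bias m \<eta> s i\<bar> \<le> 1"
proof -
  have "i div m < d" using assms(3) by (simp add: less_mult_imp_div_less)
  then show ?thesis using bits_cases[OF assms(1), of "i div m"] assms(2) by (auto simp: bias_def)
qed

lemma mix_const [simp]: "mix d m \<eta> (\<lambda>_ _. c) = c"
  by (simp add: mix_def)

lemma mix_add: "mix d m \<eta> (\<lambda>s y. g s y + h s y) = mix d m \<eta> g + mix d m \<eta> h"
  by (simp add: mix_def bit_exp_add)

lemma mix_cmult: "mix d m \<eta> (\<lambda>s y. c * h s y) = c * mix d m \<eta> h"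
  by (simp add: mix_def bit_exp_cmult)

lemma mix_sum: "mix d m \<eta> (\<lambda>s y. \<Sum>j\<in>J. h j s y) = (\<Sum>j\<in>J. mix d m \<eta> (h j))"
  by (simp add: mix_def bit_exp_sum)

lemma mix_mono:
  assumes "\<bar>\<eta>\<bar> \<le> 1" and "\<And>s y. s \<in> bits d \<Longrightarrow> y \<in> bits (d * m) \<Longrightarrow> g s y \<le> h s y"
  shows "mix d m \<eta> g \<le> mix d m \<eta> h"
  unfolding mix_def using assms by (intro bit_exp_mono bias_le) auto

lemma mix_integral:
  assumes "\<And>y. y \<in> bits (d * m) \<Longrightarrow> integrable M (h y)"
  shows "integrable M (\<lambda>\<omega>. mix d m \<eta> (\<lambda>s y. h y \<omega>))"
    and "(\<integral>\<omega>. mix d m \<eta> (\<lambda>s y. h y \<omega>) \<partial>M) = mix d m \<eta> (\<lambda>s y. \<integral>\<omega>. h y \<omega> \<partial>M)"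
proof -
  have int: "integrable M (\<lambda>\<omega>. bit_exp (d * m) (bias m \<eta> s) (\<lambda>y. h y \<omega>))" for s
    by (rule bit_exp_integral(1)[OF assms])
  show "integrable M (\<lambda>\<omega>. mix d m \<eta> (\<lambda>s y. h y \<omega>))"
    unfolding mix_def by (rule bit_exp_integral(1)[OF int])
  show "(\<integral>\<omega>. mix d m \<eta> (\<lambda>s y. h y \<omega>) \<partial>M) = mix d m \<eta> (\<lambda>s y. \<integral>\<omega>. h y \<omega> \<partial>M)"
    unfolding mix_def by (simp add: bit_exp_integral(2)[OF int] bit_exp_integral(2)[OF assms])
qed

text \<open>For each block \<open>j\<close> the signs \<open>s\<close> and \<open>s\<close> with
  entry \<open>j\<close> flipped give two hypotheses that differ on that block only, so
  \<open>adaptive_two_point\<close> bounds the correlation of guess and sign by the expected number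
  of queries to the block. Summed over the blocks, these numbers are at most
  \<open>K\<close>.\<close>

lemma mix_sign_correlation:
  fixes B :: "(nat \<Rightarrow> real) \<Rightarrow> nat \<Rightarrow> real" and S :: "real list \<Rightarrow> (nat \<Rightarrow> real) step"
  assumes dep: "\<And>y y' r. y (r div 4) = y' (r div 4) \<Longrightarrow> B y r = B y' r"
    and lam: "0 < lam" and \<eta>: "\<bar>\<eta>\<bar> < 1"
  shows "mix d m \<eta> (\<lambda>s y. \<Sum>j<d. s j * pm_sign (run S (B y) K [] j))
    \<le> lam / 2 * (\<eta>\<^sup>2 * real K) + real d / (2 * lam)"
proof -
  define R where "R = (\<lambda>j. (\<lambda>r. r div 4) -` {i. i div m = j})"
  define Q where "Q = (\<lambda>j y. query_count S (B y) (R j) K [])"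
  define G where "G = (\<lambda>j s. bit_exp (d * m) (bias m \<eta> s) (\<lambda>y. pm_sign (run S (B y) K [] j)))"
  define H where "H = (\<lambda>j s. bit_exp (d * m) (bias m \<eta> s) (Q j))"
  let ?E = "bit_exp d (\<lambda>_. 0)"
  have single: "mix d m \<eta> (\<lambda>s y. s j * pm_sign (run S (B y) K [] j))
      \<le> lam / 2 * (\<eta>\<^sup>2 * mix d m \<eta> (\<lambda>s. Q j)) + 1 / (2 * lam)" if j: "j < d" for j
  proof -
    let ?fl = "\<lambda>s::nat \<Rightarrow> real. s(j := - s j)"
    have "s j * G j s + (- 1) * (s j * G j (?fl s)) \<le> lam / 2 * \<eta>\<^sup>2 * (H j s + H j (?fl s)) + 1 / lam"
      if s: "s \<in> bits d" for s
    proof -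
      have sj: "s j = -1 \<or> s j = 1" using bits_cases[OF s j] .
      \<comment> \<open>Both hypotheses start with weight 1, so the initial potential is 0. The bias
        parameter is \<open>\<eta> * s j\<close>, which covers both orders of the two
        hypotheses.\<close>
      have "1 * bit_exp (d * m) (bias m \<eta> s) (\<lambda>y. (s j * pm_sign (run S (B y) K [] j)))
          - 1 * bit_exp (d * m) (bias m \<eta> (?fl s)) (\<lambda>y. (s j * pm_sign (run S (B y) K [] j)))
        \<le> lam / 2 * ((1 - 1)\<^sup>2 / (1 + 1) + (\<eta> * s j)\<^sup>2 *
             (1 * bit_exp (d * m) (bias m \<eta> s) (\<lambda>y. query_count S (B y) ((\<lambda>r. r div 4) -` {i. i div m = j}) K [])
            + 1 * bit_exp (d * m) (bias m \<eta> (?fl s)) (\<lambda>y. query_count S (B y) ((\<lambda>r. r div 4) -` {i. i div m = j}) K [])))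
          + (1 + 1) / (2 * lam)"
      proof (rule adaptive_two_point)
        show "\<bar>\<eta> * s j\<bar> < 1" using sj \<eta> by auto
        show "\<bar>s j * pm_sign (x j)\<bar> \<le> 1" for x using sj by (auto simp: pm_sign_def)
        show "\<bar>bias m \<eta> s i\<bar> \<le> 1" if "i < d * m" for i using s \<eta> that by (intro bias_le) auto
        show "B y r = B y' r" if "y (r div 4) = y' (r div 4)" for y y' r using that by (rule dep)
      qed (use lam in \<open>auto simp: bias_def\<close>)
      moreover have "(s j)\<^sup>2 = 1" using sj by auto
      ultimately show ?thesis
        unfolding bit_exp_cmult G_def H_def Q_def R_def by (simp add: power_mult_distrib algebra_simps)
    qed
    then have "?E (\<lambda>s. s j * G j s + (- 1) * (s j * G j (?fl s)))
        \<le> ?E (\<lambda>s. lam / 2 * \<eta>\<^sup>2 * (H j s + H j (?fl s)) + 1 / lam)"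
      by (intro bit_exp_mono) auto
    moreover have "?E (\<lambda>s. s j * G j (?fl s)) = - ?E (\<lambda>s. s j * G j s)"
    proof -
      \<comment> \<open>Substituting the flipped signs turns \<open>s j\<close> into
        \<open>- s j\<close>. The difference of the two terms above therefore averages to twice the
        correlation.\<close>
      have "?E (\<lambda>s. (- 1) * (s j * G j (?fl s))) = ?E (\<lambda>s. s j * G j s)"
        using bit_exp_flip[OF j, of "\<lambda>_. 0" "\<lambda>s. s j * G j s"] by simp
      then show ?thesis unfolding bit_exp_cmult by simp
    qed
    moreover have "?E (\<lambda>s. H j (?fl s)) = ?E (H j)"
      by (rule bit_exp_flip[OF j]) simp
    ultimately have "2 * ?E (\<lambda>s. s j * G j s) \<le> lam / 2 * \<eta>\<^sup>2 * (2 * ?E (H j)) + 1 / lam"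
      unfolding bit_exp_add bit_exp_cmult bit_exp_const by simp
    then show ?thesis
      unfolding mix_def bit_exp_cmult G_def H_def by (simp add: field_simps)
  qed
  have "(\<Sum>j<d. indicat_real (R j) r) \<le> 1" for r
  proof -
    have "(\<Sum>j<d. indicat_real (R j) r) = (\<Sum>j<d. if j = r div 4 div m then 1 else 0)"
      by (intro sum.cong) (auto simp: R_def indicator_def)
    then show ?thesis by simp
  qed
  then have "(\<Sum>j<d. Q j y) \<le> real K" for y
    unfolding Q_def by (intro query_count_le)
  then have "mix d m \<eta> (\<lambda>s y. \<Sum>j<d. Q j y) \<le> mix d m \<eta> (\<lambda>s y. real K)"
    using \<eta> by (intro mix_mono) auto
  then have total: "(\<Sum>j<d. mix d m \<eta> (\<lambda>s. Q j)) \<le> real K"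
    by (simp add: mix_sum)
  have "mix d m \<eta> (\<lambda>s y. \<Sum>j<d. s j * pm_sign (run S (B y) K [] j))
      \<le> (\<Sum>j<d. lam / 2 * (\<eta>\<^sup>2 * mix d m \<eta> (\<lambda>s. Q j)) + 1 / (2 * lam))"
    unfolding mix_sum using single by (intro sum_mono) auto
  also have "\<dots> = lam / 2 * (\<eta>\<^sup>2 * (\<Sum>j<d. mix d m \<eta> (\<lambda>s. Q j))) + real d / (2 * lam)"
    by (simp add: sum.distrib sum_distrib_left)
  also have "\<dots> \<le> lam / 2 * (\<eta>\<^sup>2 * real K) + real d / (2 * lam)"
    using total lam by (intro add_right_mono mult_left_mono) auto
  finally show ?thesis .
qed

text \<open>Up to the sign \<open>s j\<close>, the squared quantity is the centered sum of the
  \<open>m\<close> bits of block \<open>j\<close>, and each bit has variance at most 1.\<close>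

lemma mix_block_variance:
  assumes "\<bar>\<eta>\<bar> \<le> 1"
  shows "mix d m \<eta> (\<lambda>s y. \<Sum>j<d. (s j * block_sum m y j - \<eta> * real m)\<^sup>2) \<le> real d * real m"
proof -
  have "bit_exp (d * m) (bias m \<eta> s) (\<lambda>y. \<Sum>j<d. (s j * block_sum m y j - \<eta> * real m)\<^sup>2) \<le> real d * real m"
    if s: "s \<in> bits d" for s
  proof -
    have "bit_exp (d * m) (bias m \<eta> s) (\<lambda>y. (s j * block_sum m y j - \<eta> * real m)\<^sup>2) \<le> real m"
      if j: "j < d" for j
    proof -
      let ?B = "{j * m..<j * m + m}"
      have "Suc j * m \<le> d * m" using j by (intro mult_le_mono1) auto
      then have B: "?B \<subseteq> {..<d * m}" by auto
      have sj: "s j = -1 \<or> s j = 1" using bits_cases[OF s j] .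
      have "i div m = j" if "i \<in> ?B" for i
        using that by (intro div_nat_eqI) (auto simp: mult.commute)
      then have "(\<Sum>i\<in>?B. y i - bias m \<eta> s i) = (\<Sum>i\<in>?B. y i - \<eta> * s j)" for y
        by (intro sum.cong) (auto simp: bias_def)
      then have e: "(\<Sum>i\<in>?B. y i - bias m \<eta> s i) = block_sum m y j - real m * (\<eta> * s j)" for y
        by (simp add: block_sum_def sum_subtractf)
      have "(s j * block_sum m y j - \<eta> * real m)\<^sup>2 = (\<Sum>i\<in>?B. y i - bias m \<eta> s i)\<^sup>2" for y
        unfolding e using sj by (auto simp: power2_eq_square algebra_simps)
      then have "bit_exp (d * m) (bias m \<eta> s) (\<lambda>y. (s j * block_sum m y j - \<eta> * real m)\<^sup>2)
          = (\<Sum>i\<in>?B. 1 - (bias m \<eta> s i)\<^sup>2)"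
        using bit_exp_variance[OF _ B] by simp
      also have "\<dots> \<le> (\<Sum>i\<in>?B. 1)" by (intro sum_mono) auto
      finally show ?thesis by simp
    qed
    then have "bit_exp (d * m) (bias m \<eta> s) (\<lambda>y. \<Sum>j<d. (s j * block_sum m y j - \<eta> * real m)\<^sup>2) \<le> (\<Sum>j<d. real m)"
      unfolding bit_exp_sum by (intro sum_mono) auto
    then show ?thesis by simp
  qed
  then have "mix d m \<eta> (\<lambda>s y. \<Sum>j<d. (s j * block_sum m y j - \<eta> * real m)\<^sup>2)
      \<le> bit_exp d (\<lambda>_. 0) (\<lambda>_. real d * real m)"
    unfolding mix_def by (intro bit_exp_mono) auto
  then show ?thesis by simp
qed

text \<open>Here \<open>t\<close> is a block sum, \<open>s\<close> the true sign, \<open>v\<close>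
  the guess and \<open>a\<close> the mean of \<open>s * t\<close>. A wrong guess loses at least
  \<open>2 * (s * t)\<close>, which is at least \<open>a\<close> unless \<open>s * t\<close> is far
  below its mean; the last term pays for that deviation. A right guess makes the left-hand side
  0.\<close>

lemma wrong_sign_cost:
  fixes t a v s :: real
  assumes "0 < a" and "v = -1 \<or> v = 1" and "s = -1 \<or> s = 1"
  shows "(1 - s * v) * (a / 2) \<le> (\<bar>t\<bar> - v * t) + (s * t - a)\<^sup>2 / a"
proof -
  have *: "a - 2 * X \<le> (X - a)\<^sup>2 / a" for X
    using assms(1) zero_le_power2[of X] by (simp add: field_simps power2_eq_square)
  have nonneg: "0 \<le> (s * t - a)\<^sup>2 / a" using assms(1) by simp
  have t: "s * t \<le> \<bar>t\<bar>" using assms(3) by auto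
  show ?thesis
  proof (cases "v = s")
    case True
    then have "s * v = 1" using assms(3) by auto
    then show ?thesis using nonneg t True by simp
  next
    case False
    then have "v = - s" using assms(2,3) by auto
    moreover then have "s * v = -1" using assms(3) by auto
    ultimately show ?thesis using *[of "s * t"] t by simp
  qed
qed

text \<open>The set \<open>W\<close> collects the bit vectors on which the output is near-optimal.
  There \<open>wrong_sign_cost\<close> forces the guesses to correlate with \<open>s\<close>, up to
  deviations of the block sums, while \<open>mix_sign_correlation\<close> says that few queries
  cannot achieve this on average.\<close>

lemma mix_success_le:
  fixes S :: "real list \<Rightarrow> (nat \<Rightarrow> real) step" and W :: "(nat \<Rightarrow> real) set"
  assumes \<eta>: "0 < \<eta>" "\<eta> < 1" and m: "0 < m"
    and dep: "\<And>y y' r. y (r div 4) = y' (r div 4) \<Longrightarrow> B y r = B y' r"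
    and good: "\<And>y. y \<in> bits (d * m) \<Longrightarrow> y \<in> W \<Longrightarrow>
      (\<Sum>j<d. \<bar>block_sum m y j\<bar> - pm_sign (run S (B y) K [] j) * block_sum m y j) \<le> \<delta> * real (d * m)"
    and \<delta>: "0 \<le> \<delta>"
  shows "real d \<le> 2 * \<eta>\<^sup>2 * real K + real d / 8 + 2 * \<delta> / \<eta> * real d
     + 2 * real d / (\<eta>\<^sup>2 * real m) + 2 * real d * (1 - mix d m \<eta> (\<lambda>s y. indicat_real W y))"
proof -
  define v where "v = (\<lambda>y j. pm_sign (run S (B y) K [] j))"
  define a where "a = \<eta> * real m"
  have a: "0 < a" using \<eta> m by (simp add: a_def)
  define V where "V = (\<lambda>s y. \<Sum>j<d. (s j * block_sum m y j - \<eta> * real m)\<^sup>2)"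
  have v: "v y j = -1 \<or> v y j = 1" for y j by (auto simp: v_def pm_sign_def)
  have pointwise: "real d \<le> (\<Sum>j<d. s j * v y j) + (2 * \<delta> / \<eta> * real d)
      + 2 / a\<^sup>2 * V s y + 2 * real d * (1 + (- 1) * indicat_real W y)"
    if s: "s \<in> bits d" and y: "y \<in> bits (d * m)" for s y
  proof -
    have sj: "s j = -1 \<or> s j = 1" if "j < d" for j using bits_cases[OF s that] .
    have V: "0 \<le> V s y" unfolding V_def by (intro sum_nonneg) auto
    show ?thesis
    proof (cases "y \<in> W")
      case True
      have "(\<Sum>j<d. (1 - s j * v y j) * (a / 2))
          \<le> (\<Sum>j<d. (\<bar>block_sum m y j\<bar> - v y j * block_sum m y j) + (s j * block_sum m y j - a)\<^sup>2 / a)"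
        using a v sj by (intro sum_mono wrong_sign_cost) auto
      also have "\<dots> = (\<Sum>j<d. \<bar>block_sum m y j\<bar> - v y j * block_sum m y j) + V s y / a"
        unfolding V_def by (simp add: sum.distrib sum_divide_distrib a_def)
      also have "\<dots> \<le> \<delta> * real (d * m) + V s y / a"
        using good[OF y True] unfolding v_def by simp
      finally have "(\<Sum>j<d. 1 - s j * v y j) * (a / 2) \<le> \<delta> * real (d * m) + V s y / a"
        unfolding sum_distrib_right .
      \<comment> \<open>Multiplication by \<open>2 / a\<close> turns the cost into a bound on
        \<open>d\<close> minus the correlation.\<close>
      then have "(\<Sum>j<d. 1 - s j * v y j) * (a / 2) * (2 / a) \<le> (\<delta> * real (d * m) + V s y / a) * (2 / a)"
        using a by (intro mult_right_mono) auto
      moreover have "(\<delta> * real (d * m) + V s y / a) * (2 / a) = 2 * \<delta> / \<eta> * real d + 2 / a\<^sup>2 * V s y"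
        using \<eta> m unfolding a_def by (simp add: field_simps power2_eq_square)
      ultimately show ?thesis using a True by (simp add: sum_subtractf)
    next
      case False
      \<comment> \<open>Outside \<open>W\<close> the correlation may be as low as
        \<open>- d\<close>, which the failure term \<open>2 * d\<close> makes up for.\<close>
      have "(\<Sum>j<d. -1) \<le> (\<Sum>j<d. s j * v y j)"
      proof (rule sum_mono)
        fix j assume "j \<in> {..<d}"
        then show "-1 \<le> s j * v y j" using sj[of j] v[of y j] by auto
      qed
      moreover have "0 \<le> 2 * \<delta> / \<eta> * real d" "0 \<le> 2 / a\<^sup>2 * V s y" using \<eta> \<delta> V by auto
      ultimately show ?thesis using False by simp
    qed
  qed
  have "mix d m \<eta> (\<lambda>_ _. real d) \<le> mix d m \<eta> (\<lambda>s y. (\<Sum>j<d. s j * v y j) + (2 * \<delta> / \<eta> * real d)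
      + 2 / a\<^sup>2 * V s y + 2 * real d * (1 + (- 1) * indicat_real W y))"
    using \<eta> pointwise by (intro mix_mono) auto
  then have "real d \<le> mix d m \<eta> (\<lambda>s y. \<Sum>j<d. s j * v y j) + 2 * \<delta> / \<eta> * real d
      + 2 / a\<^sup>2 * mix d m \<eta> V + 2 * real d * (1 - mix d m \<eta> (\<lambda>s y. indicat_real W y))"
    unfolding mix_add mix_cmult mix_const by simp
  \<comment> \<open>The choice \<open>lam = 4\<close> leaves the constant error
    \<open>d / 8\<close>, at the price of a factor 2 in front of the query term.\<close>
  moreover have "mix d m \<eta> (\<lambda>s y. \<Sum>j<d. s j * v y j) \<le> 4 / 2 * (\<eta>\<^sup>2 * real K) + real d / (2 * 4)"
    unfolding v_def
  proof (rule mix_sign_correlation)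
    show "B y r = B y' r" if "y (r div 4) = y' (r div 4)" for y y' r using that by (rule dep)
  qed (use \<eta> in auto)
  moreover have "2 / a\<^sup>2 * mix d m \<eta> V \<le> 2 / a\<^sup>2 * (real d * real m)"
    using mix_block_variance[of \<eta> d m] \<eta> unfolding V_def by (intro mult_left_mono) auto
  moreover have "2 / a\<^sup>2 * (real d * real m) = 2 * real d / (\<eta>\<^sup>2 * real m)"
    using \<eta> m unfolding a_def by (simp add: field_simps power2_eq_square)
  ultimately show ?thesis by linarith
qed

text \<open>The averaging half of Yao's principle: the success probability averaged over inputs is
  the expectation over \<omega> of the success mass of the fixed strategy, so some \<omega> reaches
  \<alpha>. This leaves one deterministic strategy to refute.\<close>

lemma (in prob_space) ex_mix_success:
  assumes "\<And>y. y \<in> bits (d * m) \<Longrightarrow> E y \<in> events \<and> \<alpha> \<le> prob (E y)" and \<eta>: "\<bar>\<eta>\<bar> \<le> 1"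
  shows "\<exists>\<omega>\<in>space M. \<alpha> \<le> mix d m \<eta> (\<lambda>s y. indicat_real {y. \<omega> \<in> E y} y)"
proof (rule ccontr)
  assume neg: "\<not> ?thesis"
  let ?X = "\<lambda>\<omega>. mix d m \<eta> (\<lambda>s y. indicat_real (E y) \<omega>)"
  have eq: "indicat_real {y. \<omega> \<in> E y} y = indicat_real (E y) \<omega>" for \<omega> y by (simp add: indicator_def)
  have int: "integrable M (\<lambda>\<omega>. indicat_real (E y) \<omega>)" if "y \<in> bits (d * m)" for y
    using assms(1)[OF that] by (auto intro: integrable_real_indicator simp: emeasure_eq_measure)
  have "expectation ?X < \<alpha>"
    using neg unfolding eq by (intro expectation_less mix_integral(1) int) (auto simp: not_le)
  moreover have "expectation ?X = mix d m \<eta> (\<lambda>s y. expectation (indicat_real (E y)))"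
    by (rule mix_integral(2)[OF int])
  moreover have "\<alpha> = mix d m \<eta> (\<lambda>s y. \<alpha>)" by simp
  moreover have "mix d m \<eta> (\<lambda>s y. \<alpha>) \<le> mix d m \<eta> (\<lambda>s y. expectation (indicat_real (E y)))"
    using assms by (intro mix_mono) auto
  ultimately show False by linarith
qed

section \<open>Choice of constants and the final contradiction\<close>

theorem theorem2:
  fixes p :: real
  assumes "1 \<le> p"
  shows "\<exists>c C \<epsilon>0. c > 0 \<and> C > 0 \<and> \<epsilon>0 > 0 \<and>
    (\<forall>\<epsilon> (d::nat) (n::nat) (M :: 'r measure)
        (alg :: 'r \<Rightarrow> (nat \<Rightarrow> nat \<Rightarrow> real) \<Rightarrow> (real \<Rightarrow> real) \<Rightarrow> real list \<Rightarrow> (nat \<Rightarrow> real) step).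
      0 < \<epsilon> \<longrightarrow> \<epsilon> < \<epsilon>0 \<longrightarrow> 2 \<le> d \<longrightarrow> real n \<ge> C * (real d * ln (real d)) / \<epsilon>\<^sup>2 \<longrightarrow>
      prob_space M \<longrightarrow>
      (\<forall>A b f. valid_input n d A b \<longrightarrow> lip1 f \<longrightarrow> minimizers p n d A f b \<noteq> {} \<longrightarrow>
         (\<exists>E \<in> sets M. measure M E \<ge> 4/5 \<and>
           (\<forall>\<omega> \<in> E. \<exists>k xh. halts (alg \<omega> A f) b k xh \<and>
              loss p n d A f b xh \<le> OPT p n d A f b
                 + \<epsilon> * (OPT p n d A f b + normAxstar p n d A f b)))) \<longrightarrow>
      (\<exists>A b f. valid_input n d A b \<and> lip1 f \<and>
         (\<exists>\<omega> \<in> space M. \<not> (\<exists>k xh. halts (alg \<omega> A f) b k xh \<and> real k < c * real d / \<epsilon>\<^sup>2))))"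
proof (rule exI[of _ "1/320000"], rule exI[of _ 8], rule exI[of _ "1/200"], intro conjI allI impI)
  show "0 < (1/320000 :: real)" "0 < (8::real)" "0 < (1/200 :: real)" by simp_all
next
  fix \<epsilon> :: real and d n :: nat and M :: "'r measure"
    and alg :: "'r \<Rightarrow> (nat \<Rightarrow> nat \<Rightarrow> real) \<Rightarrow> (real \<Rightarrow> real) \<Rightarrow> real list \<Rightarrow> (nat \<Rightarrow> real) step"
  assume \<epsilon>: "0 < \<epsilon>" "\<epsilon> < 1/200" and d: "2 \<le> d"
    and n: "8 * (real d * ln (real d)) / \<epsilon>\<^sup>2 \<le> real n" and M: "prob_space M"
    and correct: "\<forall>A b f. valid_input n d A b \<longrightarrow> lip1 f \<longrightarrow> minimizers p n d A f b \<noteq> {} \<longrightarrow>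
         (\<exists>E \<in> sets M. measure M E \<ge> 4/5 \<and>
           (\<forall>\<omega> \<in> E. \<exists>k xh. halts (alg \<omega> A f) b k xh \<and>
              loss p n d A f b xh \<le> OPT p n d A f b
                 + \<epsilon> * (OPT p n d A f b + normAxstar p n d A f b)))"
  interpret prob_space M by (rule M)
  show "\<exists>A b f. valid_input n d A b \<and> lip1 f \<and>
         (\<exists>\<omega> \<in> space M. \<not> (\<exists>k xh. halts (alg \<omega> A f) b k xh \<and> real k < 1/320000 * real d / \<epsilon>\<^sup>2))"
  proof (rule ccontr)
    assume few: "\<not> ?thesis"
    \<comment> \<open>The factor 100 keeps the error term
      \<open>2 * (9 * \<epsilon>) / \<eta>\<close> at 18/100. The block length gives
      \<open>\<eta>\<^sup>2 * m\<close> at least 20, so the bias of a block stands out from its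
      fluctuation. The budget \<open>K\<close> gives \<open>2 * \<eta>\<^sup>2 * K\<close> at most
      \<open>d / 16\<close>, as 320000 is 16 times 20000.\<close>
    define \<eta> where "\<eta> = 100 * \<epsilon>"
    define m where "m = nat \<lceil>1 / (500 * \<epsilon>\<^sup>2)\<rceil>"
    define K where "K = nat \<lfloor>1/320000 * real d / \<epsilon>\<^sup>2\<rfloor>"
    have \<eta>: "0 < \<eta>" "\<eta> < 1" using \<epsilon> by (auto simp: \<eta>_def)
    have \<epsilon>2: "0 < \<epsilon>\<^sup>2" "\<epsilon>\<^sup>2 \<le> 1/2" using \<epsilon> power_mono[of \<epsilon> "1/200" 2] by (auto simp: power2_eq_square)
    have pos: "0 < 1 / (500 * \<epsilon>\<^sup>2)" using \<epsilon> by simp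
    have m_ge: "1 / (500 * \<epsilon>\<^sup>2) \<le> real m" unfolding m_def by linarith
    have m: "0 < m" using m_ge pos by (cases m) auto
    \<comment> \<open>The slack between 1/500 and 1 absorbs the rounding up of
      \<open>m\<close>.\<close>
    have "real m \<le> 1 / (500 * \<epsilon>\<^sup>2) + 1" using pos unfolding m_def by linarith
    also have "\<dots> \<le> 1 / (500 * \<epsilon>\<^sup>2) + (499/500) / \<epsilon>\<^sup>2"
    proof (rule add_left_mono)
      show "1 \<le> (499/500) / \<epsilon>\<^sup>2" using \<epsilon>2 by (subst pos_le_divide_eq) linarith+
    qed
    also have "\<dots> = 1 / \<epsilon>\<^sup>2" using \<epsilon>2 by (simp add: field_simps)
    finally have m_le: "real m \<le> 1 / \<epsilon>\<^sup>2" .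
    \<comment> \<open>The constant 8 is 4 rows per bit times 2, because \<open>ln d\<close> is at
      least 1/2 when \<open>d\<close> is at least 2.\<close>
    have size: "4 * (d * m) \<le> n"
    proof -
      have "1 / 2 \<le> ln (2::real)" using ln2_ge_two_thirds by simp
      also have "\<dots> \<le> ln (real d)" using d by simp
      finally have "4 * (real d * 1) \<le> 4 * (real d * (2 * ln (real d)))" by (intro mult_left_mono) auto
      then have "4 * real d / \<epsilon>\<^sup>2 \<le> 8 * (real d * ln (real d)) / \<epsilon>\<^sup>2"
        by (intro divide_right_mono) auto
      moreover have "4 * (real d * real m) \<le> 4 * (real d * (1 / \<epsilon>\<^sup>2))"
        using m_le by (intro mult_left_mono) auto
      ultimately have "real (4 * (d * m)) \<le> real n" using n by simp
      then show ?thesis by linarith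
    qed
    define A where "A = hard_mat m d"
    define b where "b = hard_vec m d"
    have valid: "valid_input n d A (b y)" for y
      unfolding A_def b_def by (rule valid_input_hard[OF size])
    have "\<exists>E. E \<in> events \<and> 4/5 \<le> prob E \<and>
           (\<forall>\<omega> \<in> E. \<exists>k xh. halts (alg \<omega> A clip) (b y) k xh \<and>
              loss p n d A clip (b y) xh \<le> OPT p n d A clip (b y)
                 + \<epsilon> * (OPT p n d A clip (b y) + normAxstar p n d A clip (b y)))"
      if y: "y \<in> bits (d * m)" for y
    proof -
      have "minimizers p n d A clip (b y) \<noteq> {}"
        using best_minimizer[OF assms size y] unfolding A_def b_def by blast
      then show ?thesis using correct valid lip1_clip by blast
    qed
    then obtain E where E: "\<And>y. y \<in> bits (d * m) \<Longrightarrow> E y \<in> events \<and> 4/5 \<le> prob (E y)"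
      and success: "\<And>y \<omega>. y \<in> bits (d * m) \<Longrightarrow> \<omega> \<in> E y \<Longrightarrow>
          \<exists>k xh. halts (alg \<omega> A clip) (b y) k xh \<and>
              loss p n d A clip (b y) xh \<le> OPT p n d A clip (b y)
                 + \<epsilon> * (OPT p n d A clip (b y) + normAxstar p n d A clip (b y))"
      by metis
    obtain \<omega> where \<omega>: "\<omega> \<in> space M"
      and mass: "4/5 \<le> mix d m \<eta> (\<lambda>s y. indicat_real {y. \<omega> \<in> E y} y)"
      using ex_mix_success[of d m E "4/5" \<eta>, OF E] \<eta> by auto
    define S where "S = alg \<omega> A clip"
    have good: "(\<Sum>j<d. \<bar>block_sum m y j\<bar> - pm_sign (run S (b y) K [] j) * block_sum m y j)
        \<le> 9 * \<epsilon> * real (d * m)" if y: "y \<in> bits (d * m)" and w: "y \<in> {y. \<omega> \<in> E y}" for y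
    proof -
      obtain k xh where k: "halts S (b y) k xh" and opt: "loss p n d A clip (b y) xh \<le> OPT p n d A clip (b y)
                 + \<epsilon> * (OPT p n d A clip (b y) + normAxstar p n d A clip (b y))"
        using success[OF y] w unfolding S_def by blast
      \<comment> \<open>Correctness supplies a good output with no bound on the halting time, and
        the assumed query bound supplies an early halt. Uniqueness of the output identifies the
        two.\<close>
      obtain k' x' where k': "halts S (b y) k' x'" "real k' < 1/320000 * real d / \<epsilon>\<^sup>2"
        using few valid lip1_clip \<omega> unfolding S_def by blast
      have "k' \<le> K" using k'(2) unfolding K_def by linarith
      then have "run S (b y) K [] = xh"
        using halts_imp_run[OF k'(1)] halts_unique[OF k k'(1)] by simp
      then show ?thesis
        using approx_minimizer_signs[OF assms size y \<epsilon>(1)] opt unfolding A_def b_def by blast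
    qed
    \<comment> \<open>The terms on the right are at most 1/16, 1/8, 18/100, 1/10 and 2/5 times
      \<open>d\<close>. They add up to less than \<open>d\<close>, a contradiction.\<close>
    have "real d \<le> 2 * \<eta>\<^sup>2 * real K + real d / 8 + 2 * (9 * \<epsilon>) / \<eta> * real d
     + 2 * real d / (\<eta>\<^sup>2 * real m) + 2 * real d * (1 - mix d m \<eta> (\<lambda>s y. indicat_real {y. \<omega> \<in> E y} y))"
    proof (rule mix_success_le[OF \<eta> m _ good])
      show "b y r = b y' r" if "y (r div 4) = y' (r div 4)" for y y' r
        using that unfolding b_def by (rule hard_vec_dep)
    qed (use \<epsilon> in auto)
    moreover have "2 * \<eta>\<^sup>2 * real K \<le> real d / 16"
    proof -
      have "real K \<le> 1/320000 * real d / \<epsilon>\<^sup>2" unfolding K_def using \<epsilon> by simp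
      then have "2 * \<eta>\<^sup>2 * real K \<le> 2 * \<eta>\<^sup>2 * (1/320000 * real d / \<epsilon>\<^sup>2)" by (intro mult_left_mono) auto
      then show ?thesis using \<epsilon> by (simp add: \<eta>_def power_mult_distrib)
    qed
    moreover have "2 * (9 * \<epsilon>) / \<eta> * real d = 18/100 * real d" using \<epsilon> by (simp add: \<eta>_def)
    moreover have "2 * real d / (\<eta>\<^sup>2 * real m) \<le> 2 * real d / 20"
    proof (rule divide_left_mono)
      have "\<eta>\<^sup>2 * (1 / (500 * \<epsilon>\<^sup>2)) \<le> \<eta>\<^sup>2 * real m" using m_ge by (intro mult_left_mono) auto
      then show "20 \<le> \<eta>\<^sup>2 * real m" using \<epsilon> by (simp add: \<eta>_def power_mult_distrib)
    qed (use \<eta> m in auto)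
    moreover have "2 * real d * (1 - mix d m \<eta> (\<lambda>s y. indicat_real {y. \<omega> \<in> E y} y)) \<le> 2 * real d * (1/5)"
      using mass by (intro mult_left_mono) auto
    moreover have "0 < real d" using d by simp
    ultimately show False by linarith
  qed
qed

end
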